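(* (i) Let $\mathfrak h$ be a real Lie algebra of dimension $n$ with bracket $[\,,]_{\mathfrak h}$, let $\rho:\mathfrak h\to\operatorname{End}(\mathfrak h^* )$ be a representation of $\mathfrak h$ on its dual space, written $x\cdot\varphi=\rho(x)\varphi$, let $\alpha\in Z^2(\mathfrak h,\mathfrak h^* )$ be a 2-cocycle, and let $\mathfrak g=\mathfrak h^*\oplus\mathfrak h$ be the $2n$-dimensional Lie algebra, with abelian ideal $\mathfrak h^*$, whose bracket is $$[\varphi,\eta]=0,\qquad [\varphi,x]=-x\cdot\varphi,\qquad [x,y]=[x,y]_{\mathfrak h}+\alpha(x,y)\qquad(\varphi,\eta\in\mathfrak h^*,\ x,y\in\mathfrak h).$$ Then $\mathfrak g$, with the form $\omega_0$, is a solution of the cotangent extension problem if and only if $$\langle\alpha(x_1,x_2),x_3\rangle+\langle\alpha(x_2,x_3),x_1\rangle+\langle\alpha(x_3,x_1),x_2\rangle=0\quad\text{for all }x_1,x_2,x_3\in\mathfrak h$$ and $$\langle x\cdot\varphi,y\rangle-\langle y\cdot\varphi,x\rangle=-\langle\varphi,[x,y]_{\mathfrak h}\rangle\quad\text{for all }x,y\in\mathfrak h,\ \varphi\in\mathfrak h^*.$$ (ii) Let $(\mathfrak g,\omega)$ be a symplectic Lie algebra with a lagrangian ideal. Then $\mathfrak g$ is a solution of the cotangent extension problem.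
   Context: A symplectic form on a $2n$-dimensional real Lie algebra is a closed (Chevalley–Eilenberg, trivial coefficients) 2-form $\omega$ with $\omega^n\neq0$. A subspace $W$ of $(\mathfrak g,\omega)$ is lagrangian if $W^\perp=W$, where $W^\perp=\{x\in\mathfrak g:\omega(x,y)=0\ \forall y\in W\}$. $\langle\,,\rangle$ denotes evaluation of elements of $\mathfrak h^*$ on $\mathfrak h$. The cocycle condition on the alternating map $\alpha:\mathfrak h\times\mathfrak h\to\mathfrak h^*$ is $$\alpha([x_1,x_2]_{\mathfrak h},x_3)+\alpha([x_2,x_3]_{\mathfrak h},x_1)+\alpha([x_3,x_1]_{\mathfrak h},x_2)=x_3\cdot\alpha(x_1,x_2)+x_1\cdot\alpha(x_2,x_3)+x_2\cdot\alpha(x_3,x_1),$$ which is equivalent to the bracket in (i) being a Lie bracket. Cotangent extension problem: for a Lie algebra $\mathfrak h$, let $\omega_0((\varphi,x),(\varphi',x'))=\varphi(x')-\varphi'(x)$ on $\mathfrak h^*\oplus\mathfrak h$. One looks for Lie algebra structures on $\mathfrak h^*\oplus\mathfrak h$ such that (c1) $0\to\mathfrak h^*\to\mathfrak h^*\oplus\mathfrak h\to\mathfrak h\to0$ (canonical inclusion and projection) is an exact sequence of Lie algebras, $\mathfrak h^*$ being abelian; and (c2) $\omega_0$ is closed. In (i), "$\mathfrak g$ with the form $\omega_0$ is a solution" means that this Lie algebra structure on $\mathfrak h^*\oplus\mathfrak h$ satisfies (c1) and (c2). In general a symplectic Lie algebra $(\mathfrak g,\omega)$ is a solution of the cotangent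 extension problem if there is a Lie algebra isomorphism, carrying $\omega$ to $\omega_0$, from $\mathfrak g$ onto some $\mathfrak h^*\oplus\mathfrak h$ with a Lie algebra structure satisfying (c1) and (c2). *)

theory Defs
  imports "HOL-Analysis.Analysis" "HOL-Library.Function_Algebras"
begin

instantiation "fun" :: (type, real_vector) real_vector
begin

definition scaleR_fun_def: "scaleR r f = (\<lambda>x. scaleR r (f x))"

instance
  by standard (auto simp: scaleR_fun_def fun_eq_iff scaleR_add_right scaleR_add_left)

end

(* Vector spaces are subspaces of an ambient type of class real_vector. Maps are total functions
   on the ambient type; only their values on the given subspaces matter. *)

definition has_dim :: "'a::real_vector set \<Rightarrow> nat \<Rightarrow> bool" where
  "has_dim V n \<longleftrightarrow> (\<exists>B. finite B \<and> card B = n \<and> independent B \<and> span B = V)"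

definition linear_map_on ::
    "'a::real_vector set \<Rightarrow> 'b::real_vector set \<Rightarrow> ('a \<Rightarrow> 'b) \<Rightarrow> bool" where
  "linear_map_on V W f \<longleftrightarrow>
     (\<forall>x\<in>V. f x \<in> W) \<and>
     (\<forall>x\<in>V. \<forall>y\<in>V. f (x + y) = f x + f y) \<and>
     (\<forall>c. \<forall>x\<in>V. f (c *\<^sub>R x) = c *\<^sub>R f x)"

definition alternating_map_on ::
    "'a::real_vector set \<Rightarrow> 'b::real_vector set \<Rightarrow> ('a \<Rightarrow> 'a \<Rightarrow> 'b) \<Rightarrow> bool" where
  "alternating_map_on V W b \<longleftrightarrow>
     (\<forall>x\<in>V. linear_map_on V W (\<lambda>y. b x y)) \<and>
     (\<forall>y\<in>V. linear_map_on V W (\<lambda>x. b x y)) \<and>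
     (\<forall>x\<in>V. b x x = 0)"

(* Functionals on V are extended by 0 outside V, so that equality of functionals on V is
   equality of functions; the vector space operations are pointwise. *)
definition dual_space :: "'a::real_vector set \<Rightarrow> ('a \<Rightarrow> real) set" where
  "dual_space V = {\<phi>. linear_map_on V UNIV \<phi> \<and> (\<forall>x. x \<notin> V \<longrightarrow> \<phi> x = 0)}"

definition lie_algebra :: "'a::real_vector set \<Rightarrow> ('a \<Rightarrow> 'a \<Rightarrow> 'a) \<Rightarrow> bool" where
  "lie_algebra L br \<longleftrightarrow>
     subspace L \<and> alternating_map_on L L br \<and>
     (\<forall>x\<in>L. \<forall>y\<in>L. \<forall>z\<in>L. br (br x y) z + br (br y z) x + br (br z x) y = 0)"

definition lie_hom :: "'a::real_vector set \<Rightarrow> ('a \<Rightarrow> 'a \<Rightarrow> 'a) \<Rightarrow>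
    'b::real_vector set \<Rightarrow> ('b \<Rightarrow> 'b \<Rightarrow> 'b) \<Rightarrow> ('a \<Rightarrow> 'b) \<Rightarrow> bool" where
  "lie_hom L br M br' f \<longleftrightarrow>
     linear_map_on L M f \<and> (\<forall>x\<in>L. \<forall>y\<in>L. f (br x y) = br' (f x) (f y))"

definition lie_iso :: "'a::real_vector set \<Rightarrow> ('a \<Rightarrow> 'a \<Rightarrow> 'a) \<Rightarrow>
    'b::real_vector set \<Rightarrow> ('b \<Rightarrow> 'b \<Rightarrow> 'b) \<Rightarrow> ('a \<Rightarrow> 'b) \<Rightarrow> bool" where
  "lie_iso L br M br' f \<longleftrightarrow> lie_hom L br M br' f \<and> bij_betw f L M"

definition lie_ideal :: "'a::real_vector set \<Rightarrow> ('a \<Rightarrow> 'a \<Rightarrow> 'a) \<Rightarrow> 'a set \<Rightarrow> bool" where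
  "lie_ideal L br W \<longleftrightarrow>
     subspace W \<and> W \<subseteq> L \<and> (\<forall>x\<in>L. \<forall>w\<in>W. br x w \<in> W)"

definition representation_on :: "'a::real_vector set \<Rightarrow> ('a \<Rightarrow> 'a \<Rightarrow> 'a) \<Rightarrow>
    'b::real_vector set \<Rightarrow> ('a \<Rightarrow> 'b \<Rightarrow> 'b) \<Rightarrow> bool" where
  "representation_on L br V \<rho> \<longleftrightarrow>
     (\<forall>x\<in>L. linear_map_on V V (\<rho> x)) \<and>
     (\<forall>v\<in>V. linear_map_on L V (\<lambda>x. \<rho> x v)) \<and>
     (\<forall>x\<in>L. \<forall>y\<in>L. \<forall>v\<in>V. \<rho> (br x y) v = \<rho> x (\<rho> y v) - \<rho> y (\<rho> x v))"

definition two_cocycle :: "'a::real_vector set \<Rightarrow> ('a \<Rightarrow> 'a \<Rightarrow> 'a) \<Rightarrow>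
    'b::real_vector set \<Rightarrow> ('a \<Rightarrow> 'b \<Rightarrow> 'b) \<Rightarrow> ('a \<Rightarrow> 'a \<Rightarrow> 'b) \<Rightarrow> bool" where
  "two_cocycle L br V \<rho> \<alpha> \<longleftrightarrow>
     alternating_map_on L V \<alpha> \<and>
     (\<forall>x\<in>L. \<forall>y\<in>L. \<forall>z\<in>L.
        \<alpha> (br x y) z + \<alpha> (br y z) x + \<alpha> (br z x) y =
        \<rho> z (\<alpha> x y) + \<rho> x (\<alpha> y z) + \<rho> y (\<alpha> z x))"

(* The Chevalley-Eilenberg differential of a 2-form, with trivial coefficients. *)
definition ce_d :: "('a \<Rightarrow> 'a \<Rightarrow> 'a) \<Rightarrow> ('a \<Rightarrow> 'a \<Rightarrow> real) \<Rightarrow> 'a \<Rightarrow> 'a \<Rightarrow> 'a \<Rightarrow> real" where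
  "ce_d br \<omega> x y z = - \<omega> (br x y) z + \<omega> (br x z) y - \<omega> (br y z) x"

definition closed_two_form ::
    "'a::real_vector set \<Rightarrow> ('a \<Rightarrow> 'a \<Rightarrow> 'a) \<Rightarrow> ('a \<Rightarrow> 'a \<Rightarrow> real) \<Rightarrow> bool" where
  "closed_two_form L br \<omega> \<longleftrightarrow>
     alternating_map_on L UNIV \<omega> \<and> (\<forall>x\<in>L. \<forall>y\<in>L. \<forall>z\<in>L. ce_d br \<omega> x y z = 0)"

(* A k-form is a function of a sequence of vectors v that depends only on v 0, ..., v (k - 1);
   this is the exterior product of a k-form and an l-form. *)
definition wedge :: "nat \<Rightarrow> nat \<Rightarrow> ((nat \<Rightarrow> 'a) \<Rightarrow> real) \<Rightarrow> ((nat \<Rightarrow> 'a) \<Rightarrow> real) \<Rightarrow>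
    (nat \<Rightarrow> 'a) \<Rightarrow> real" where
  "wedge k l a b v =
     (\<Sum>p | p permutes {..<k + l}.
        of_int (sign p) * a (\<lambda>i. v (p i)) * b (\<lambda>i. v (p (k + i)))) / (fact k * fact l)"

fun wedge_power :: "('a \<Rightarrow> 'a \<Rightarrow> real) \<Rightarrow> nat \<Rightarrow> (nat \<Rightarrow> 'a) \<Rightarrow> real" where
  "wedge_power \<omega> 0 = (\<lambda>v. 1)"
| "wedge_power \<omega> (Suc n) = wedge 2 (2 * n) (\<lambda>v. \<omega> (v 0) (v 1)) (wedge_power \<omega> n)"

definition symplectic_lie_algebra ::
    "nat \<Rightarrow> 'a::real_vector set \<Rightarrow> ('a \<Rightarrow> 'a \<Rightarrow> 'a) \<Rightarrow> ('a \<Rightarrow> 'a \<Rightarrow> real) \<Rightarrow> bool" where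
  "symplectic_lie_algebra n G br \<omega> \<longleftrightarrow>
     lie_algebra G br \<and> has_dim G (2 * n) \<and> closed_two_form G br \<omega> \<and>
     (\<exists>v. (\<forall>i<2 * n. v i \<in> G) \<and> wedge_power \<omega> n v \<noteq> 0)"

definition symp_orth :: "'a set \<Rightarrow> ('a \<Rightarrow> 'a \<Rightarrow> real) \<Rightarrow> 'a set \<Rightarrow> 'a set" where
  "symp_orth G \<omega> W = {x \<in> G. \<forall>y\<in>W. \<omega> x y = 0}"

definition lagrangian :: "'a::real_vector set \<Rightarrow> ('a \<Rightarrow> 'a \<Rightarrow> real) \<Rightarrow> 'a set \<Rightarrow> bool" where
  "lagrangian G \<omega> W \<longleftrightarrow> subspace W \<and> W \<subseteq> G \<and> symp_orth G \<omega> W = W"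

fun omega0 :: "('a \<Rightarrow> real) \<times> 'a \<Rightarrow> ('a \<Rightarrow> real) \<times> 'a \<Rightarrow> real" where
  "omega0 (\<phi>, x) (\<phi>', x') = \<phi> x' - \<phi>' x"

definition lie_short_exact :: "'a::real_vector set \<Rightarrow> ('a \<Rightarrow> 'a \<Rightarrow> 'a) \<Rightarrow>
    'b::real_vector set \<Rightarrow> ('b \<Rightarrow> 'b \<Rightarrow> 'b) \<Rightarrow> 'c::real_vector set \<Rightarrow> ('c \<Rightarrow> 'c \<Rightarrow> 'c) \<Rightarrow>
    ('a \<Rightarrow> 'b) \<Rightarrow> ('b \<Rightarrow> 'c) \<Rightarrow> bool" where
  "lie_short_exact A brA B brB C brC i p \<longleftrightarrow>
     lie_algebra A brA \<and> lie_algebra B brB \<and> lie_algebra C brC \<and>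
     lie_hom A brA B brB i \<and> lie_hom B brB C brC p \<and>
     inj_on i A \<and> i ` A = {x \<in> B. p x = 0} \<and> p ` B = C"

(* E solves the cotangent extension problem for H: with the canonical inclusion and projection,
   dual_space H (abelian) -> dual_space H \<times> H -> H is an exact sequence of Lie algebras, and
   omega0 is closed with respect to E. *)
definition cotangent_extension :: "'a::real_vector set \<Rightarrow> ('a \<Rightarrow> 'a \<Rightarrow> 'a) \<Rightarrow>
    (('a \<Rightarrow> real) \<times> 'a \<Rightarrow> ('a \<Rightarrow> real) \<times> 'a \<Rightarrow> ('a \<Rightarrow> real) \<times> 'a) \<Rightarrow> bool" where
  "cotangent_extension H br E \<longleftrightarrow>
     lie_short_exact (dual_space H) (\<lambda>\<phi> \<eta>. 0) (dual_space H \<times> H) E H br (\<lambda>\<phi>. (\<phi>, 0)) snd \<and>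
     closed_two_form (dual_space H \<times> H) E omega0"

(* H may be taken inside the ambient type of G without loss of generality: the isomorphism makes
   any such H isomorphic to a linear subspace of G. *)
definition cotangent_solution ::
    "'a::real_vector set \<Rightarrow> ('a \<Rightarrow> 'a \<Rightarrow> 'a) \<Rightarrow> ('a \<Rightarrow> 'a \<Rightarrow> real) \<Rightarrow> bool" where
  "cotangent_solution G br \<omega> \<longleftrightarrow>
     (\<exists>(H :: 'a set) brH E \<Phi>.
        cotangent_extension H brH E \<and>
        lie_iso G br (dual_space H \<times> H) E \<Phi> \<and>
        (\<forall>x\<in>G. \<forall>y\<in>G. omega0 (\<Phi> x) (\<Phi> y) = \<omega> x y))"

(* By bilinearity and antisymmetry this is the bracket with [phi, eta] = 0, [phi, x] = - x . phi
   and [x, y] = [x, y]_H + alpha(x, y). *)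
fun ext_bracket :: "('a \<Rightarrow> 'a \<Rightarrow> 'a) \<Rightarrow> ('a \<Rightarrow> ('a \<Rightarrow> real) \<Rightarrow> ('a \<Rightarrow> real)) \<Rightarrow>
    ('a \<Rightarrow> 'a \<Rightarrow> ('a \<Rightarrow> real)) \<Rightarrow>
    ('a \<Rightarrow> real) \<times> 'a \<Rightarrow> ('a \<Rightarrow> real) \<times> 'a \<Rightarrow> ('a \<Rightarrow> real) \<times> 'a" where
  "ext_bracket br \<rho> \<alpha> (\<phi>, x) (\<eta>, y) = (\<rho> x \<eta> - \<rho> y \<phi> + \<alpha> x y, br x y)"

end

theory Submission
  imports Defs
begin

text \<open>
  Part (i). The exact sequence imposes nothing beyond the Lie algebra axioms of the extension, and
  these are the axioms of \<open>H\<close>, of the representation and of the cocycle. So only the closedness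
  of \<open>omega0\<close> is at stake. Its differential is additive in each of its three arguments, and
  evaluated on \<open>(\<phi>, x)\<close>, \<open>(\<eta>, y)\<close>, \<open>(\<zeta>, z)\<close> it splits into one term for each functional,
  which is the condition on the representation, and one term free of functionals, which is
  the condition on the cocycle. Setting all functionals, or all but one, to zero separates
  the terms (\<open>cotangent_extension_ext_bracket_iff\<close>).

  Part (ii). Let \<open>W\<close> be the lagrangian ideal. The plan is to identify \<open>G\<close> with the dual of \<open>H\<close>
  plus \<open>H\<close>, where \<open>H\<close> is a lagrangian complement of \<open>W\<close>, and where \<open>W\<close> is identified with the dual
  of \<open>H\<close> through \<open>\<omega>\<close>.

  The top power of \<open>\<omega>\<close> is alternating and multilinear, and it vanishes as soon as one argument
  lies in the radical. In dimension \<open>2 n\<close>, a non-zero radical vector could be substituted for a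
  suitable one of any \<open>2 n\<close> arguments at the cost of a non-zero factor; since the power is
  not identically zero, \<open>\<omega>\<close> is non-degenerate
  (\<open>nondegenerate_of_wedge_power\<close>), and in finite dimension every functional on \<open>G\<close> has the form
  \<open>\<omega> g\<close> (\<open>functional_representable\<close>). If the functional vanishes on \<open>W\<close>, then \<open>g\<close> lies in the
  orthogonal space of \<open>W\<close>, which is \<open>W\<close>.

  This has two uses. First, an arbitrary projection along \<open>W\<close> can be corrected by a map into \<open>W\<close> so
  that its image \<open>H\<close> becomes isotropic (\<open>lagrangian_projection\<close>). Secondly, it makes
  \<open>x \<mapsto> (\<omega> x restricted to H, projection of x to H)\<close> a bijection from \<open>G\<close> onto the dual of \<open>H\<close>
  times \<open>H\<close>. As \<open>W\<close> and \<open>H\<close> are both isotropic, this bijection carries \<open>\<omega>\<close> to \<open>omega0\<close>.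
  With the bracket of \<open>G/W\<close> on \<open>H\<close> and the transported bracket on the product, everything holds by
  transport except that the dual of \<open>H\<close>, that is \<open>W\<close>, is abelian. This comes from closedness: for
  \<open>v\<close>, \<open>w\<close> in \<open>W\<close> it expresses \<open>\<omega> [v, w] y\<close> by values of \<open>\<omega>\<close> on pairs from the isotropic ideal
  \<open>W\<close>, so that \<open>[v, w]\<close> is in the radical (\<open>lagrangian_ideal_abelian\<close>).
\<close>

section \<open>Linear and alternating maps on subspaces\<close>

lemma linear_map_onD:
  assumes "linear_map_on V W f"
  shows "x \<in> V \<Longrightarrow> f x \<in> W"
    and "x \<in> V \<Longrightarrow> y \<in> V \<Longrightarrow> f (x + y) = f x + f y"
    and "x \<in> V \<Longrightarrow> f (c *\<^sub>R x) = c *\<^sub>R f x"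
  using assms unfolding linear_map_on_def by auto

lemma linear_map_on_zero:
  assumes "linear_map_on V W f" "subspace V"
  shows "f 0 = 0"
  using linear_map_onD(3)[OF assms(1) subspace_0[OF assms(2)], of 0] by simp

lemma linear_map_on_diff:
  assumes "linear_map_on V W f" "subspace V" "x \<in> V" "y \<in> V"
  shows "f (x - y) = f x - f y"
proof -
  have "f ((x - y) + y) = f (x - y) + f y"
    by (rule linear_map_onD(2)[OF assms(1)]) (use assms in \<open>auto intro: subspace_diff\<close>)
  then show ?thesis by simp
qed

lemma linear_map_on_lincomb:
  assumes "linear_map_on V W f" "subspace V" "\<And>i. i \<in> I \<Longrightarrow> v i \<in> V"
  shows "f (\<Sum>i\<in>I. c i *\<^sub>R v i) = (\<Sum>i\<in>I. c i *\<^sub>R f (v i))"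
  using assms(3)
proof (induction I rule: infinite_finite_induct)
  case (insert i I)
  have "(\<Sum>i\<in>I. c i *\<^sub>R v i) \<in> V"
    using insert.prems assms(2) by (auto intro!: subspace_sum subspace_scale)
  moreover have "c i *\<^sub>R v i \<in> V" using insert.prems assms(2) by (auto intro: subspace_scale)
  ultimately show ?case
    using insert linear_map_onD[OF assms(1)] by simp
qed (use linear_map_on_zero[OF assms(1,2)] in auto)

lemma linear_map_on_sum:
  assumes "\<And>i. i \<in> I \<Longrightarrow> linear_map_on V UNIV (g i)"
  shows "linear_map_on V UNIV (\<lambda>x. \<Sum>i\<in>I. g i x)"
  using assms unfolding linear_map_on_def
  by (auto simp: sum.distrib scaleR_sum_right)

lemma linear_map_on_times_const:
  fixes f :: "'a::real_vector \<Rightarrow> real"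
  assumes "linear_map_on V UNIV f"
  shows "linear_map_on V UNIV (\<lambda>x. f x * c)"
  using assms unfolding linear_map_on_def by (auto simp: algebra_simps)

lemma linear_map_on_eq_on_span:
  assumes f: "linear_map_on (span B) W f" and g: "linear_map_on (span B) W' g"
    and eq: "\<And>b. b \<in> B \<Longrightarrow> f b = g b" and "x \<in> span B"
  shows "f x = g x"
proof -
  have "x \<in> span B \<and> f x = g x"
    using \<open>x \<in> span B\<close>
  proof (induction rule: span_induct)
    case base
    have "0 \<in> span B \<and> f 0 = g 0"
      using linear_map_on_zero[OF f] linear_map_on_zero[OF g] by (simp add: span_zero)
    then show ?case
      by (auto intro!: subspaceI simp: span_add span_scale
          linear_map_onD(2,3)[OF f] linear_map_onD(2,3)[OF g])
  qed (use eq span_base in auto)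
  then show ?thesis by simp
qed

lemma alternating_map_onD:
  assumes "alternating_map_on V W b"
  shows "x \<in> V \<Longrightarrow> linear_map_on V W (\<lambda>y. b x y)"
    and "y \<in> V \<Longrightarrow> linear_map_on V W (\<lambda>x. b x y)"
    and "x \<in> V \<Longrightarrow> b x x = 0"
  using assms unfolding alternating_map_on_def by auto

lemma alternating_map_on_simps:
  assumes "alternating_map_on V W b" "subspace V"
  shows "x \<in> V \<Longrightarrow> y \<in> V \<Longrightarrow> b x y \<in> W"
    and "x \<in> V \<Longrightarrow> y \<in> V \<Longrightarrow> z \<in> V \<Longrightarrow> b (x + y) z = b x z + b y z"
    and "x \<in> V \<Longrightarrow> y \<in> V \<Longrightarrow> z \<in> V \<Longrightarrow> b z (x + y) = b z x + b z y"
    and "x \<in> V \<Longrightarrow> y \<in> V \<Longrightarrow> z \<in> V \<Longrightarrow> b (x - y) z = b x z - b y z"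
    and "x \<in> V \<Longrightarrow> y \<in> V \<Longrightarrow> z \<in> V \<Longrightarrow> b z (x - y) = b z x - b z y"
    and "x \<in> V \<Longrightarrow> y \<in> V \<Longrightarrow> b (c *\<^sub>R x) y = c *\<^sub>R b x y"
    and "x \<in> V \<Longrightarrow> y \<in> V \<Longrightarrow> b y (c *\<^sub>R x) = c *\<^sub>R b y x"
    and "x \<in> V \<Longrightarrow> b 0 x = 0"
    and "x \<in> V \<Longrightarrow> b x 0 = 0"
proof -
  note right = alternating_map_onD(1)[OF assms(1)] and left = alternating_map_onD(2)[OF assms(1)]
  show "x \<in> V \<Longrightarrow> y \<in> V \<Longrightarrow> b x y \<in> W"
    by (rule linear_map_onD(1)[OF left])
  show "x \<in> V \<Longrightarrow> y \<in> V \<Longrightarrow> z \<in> V \<Longrightarrow> b (x + y) z = b x z + b y z"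
    by (rule linear_map_onD(2)[OF left])
  show "x \<in> V \<Longrightarrow> y \<in> V \<Longrightarrow> z \<in> V \<Longrightarrow> b z (x + y) = b z x + b z y"
    by (rule linear_map_onD(2)[OF right])
  show "x \<in> V \<Longrightarrow> y \<in> V \<Longrightarrow> z \<in> V \<Longrightarrow> b (x - y) z = b x z - b y z"
    by (rule linear_map_on_diff[OF left assms(2)])
  show "x \<in> V \<Longrightarrow> y \<in> V \<Longrightarrow> z \<in> V \<Longrightarrow> b z (x - y) = b z x - b z y"
    by (rule linear_map_on_diff[OF right assms(2)])
  show "x \<in> V \<Longrightarrow> y \<in> V \<Longrightarrow> b (c *\<^sub>R x) y = c *\<^sub>R b x y"
    by (rule linear_map_onD(3)[OF left])
  show "x \<in> V \<Longrightarrow> y \<in> V \<Longrightarrow> b y (c *\<^sub>R x) = c *\<^sub>R b y x"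
    by (rule linear_map_onD(3)[OF right])
  show "x \<in> V \<Longrightarrow> b 0 x = 0"
    by (rule linear_map_on_zero[OF left assms(2)])
  show "x \<in> V \<Longrightarrow> b x 0 = 0"
    by (rule linear_map_on_zero[OF right assms(2)])
qed

lemma alternating_map_on_antisym:
  assumes "alternating_map_on V W b" "subspace V" "x \<in> V" "y \<in> V"
  shows "b y x = - b x y"
proof -
  have "b (x + y) (x + y) = 0"
    by (rule alternating_map_onD(3)[OF assms(1) subspace_add[OF assms(2-4)]])
  then have "b x x + b x y + (b y x + b y y) = 0"
    using assms by (simp add: alternating_map_on_simps[OF assms(1,2)] subspace_add ac_simps)
  then show ?thesis
    using assms alternating_map_onD(3)[OF assms(1)] by (simp add: eq_neg_iff_add_eq_0 add.commute)
qed

lemma subspace_dual_space: "subspace (dual_space V)"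
  unfolding subspace_def dual_space_def linear_map_on_def
  by (auto simp: scaleR_fun_def algebra_simps)

lemma dual_spaceD:
  assumes "\<phi> \<in> dual_space V"
  shows "linear_map_on V UNIV \<phi>" and "x \<notin> V \<Longrightarrow> \<phi> x = 0"
  using assms unfolding dual_space_def by auto

lemma alternating_omega0:
  assumes "subspace H"
  shows "alternating_map_on (dual_space H \<times> H) UNIV omega0"
proof -
  note simps = linear_map_onD[OF dual_spaceD(1)]
  show ?thesis
    unfolding alternating_map_on_def
  proof (intro conjI ballI)
    fix a assume "a \<in> dual_space H \<times> H"
    then show "linear_map_on (dual_space H \<times> H) UNIV (\<lambda>b. omega0 a b)"
      "linear_map_on (dual_space H \<times> H) UNIV (\<lambda>b. omega0 b a)" "omega0 a a = 0"
      unfolding linear_map_on_def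
      by (auto simp: simps scaleR_fun_def algebra_simps)
  qed
qed

section \<open>Extensions given by a representation and a cocycle\<close>

lemma representation_onD:
  assumes "representation_on L br V \<rho>"
  shows "x \<in> L \<Longrightarrow> linear_map_on V V (\<rho> x)"
    and "v \<in> V \<Longrightarrow> linear_map_on L V (\<lambda>x. \<rho> x v)"
    and "x \<in> L \<Longrightarrow> y \<in> L \<Longrightarrow> v \<in> V \<Longrightarrow> \<rho> (br x y) v = \<rho> x (\<rho> y v) - \<rho> y (\<rho> x v)"
  using assms unfolding representation_on_def by auto

lemma lie_algebraD:
  assumes "lie_algebra L br"
  shows "subspace L" "alternating_map_on L L br"
    and "x \<in> L \<Longrightarrow> y \<in> L \<Longrightarrow> z \<in> L \<Longrightarrow> br (br x y) z + br (br y z) x + br (br z x) y = 0"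
  using assms unfolding lie_algebra_def by auto

text \<open>
  The \<open>H\<close>-component of the Jacobi identity is that of \<open>H\<close>. In the other component the terms with
  a functional cancel because \<open>\<rho>\<close> is a representation, and what is left is the
  cocycle condition.
\<close>

lemma lie_algebra_ext_bracket:
  assumes L: "lie_algebra H br" and R: "representation_on H br (dual_space H) \<rho>"
    and C: "two_cocycle H br (dual_space H) \<rho> \<alpha>"
  shows "lie_algebra (dual_space H \<times> H) (ext_bracket br \<rho> \<alpha>)"
proof -
  let ?D = "dual_space H"
  have sH: "subspace H" and aH: "alternating_map_on H H br" using lie_algebraD[OF L] by auto
  have a\<alpha>: "alternating_map_on H ?D \<alpha>"
    and coc: "\<And>x y z. x \<in> H \<Longrightarrow> y \<in> H \<Longrightarrow> z \<in> H \<Longrightarrow>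
      \<alpha> (br x y) z + \<alpha> (br y z) x + \<alpha> (br z x) y = \<rho> z (\<alpha> x y) + \<rho> x (\<alpha> y z) + \<rho> y (\<alpha> z x)"
    using C unfolding two_cocycle_def by auto
  note sD = subspace_dual_space[of H]
  note br = alternating_map_on_simps[OF aH sH]
  note al = alternating_map_on_simps[OF a\<alpha> sH]
  note r1 = linear_map_onD[OF representation_onD(1)[OF R]]
    linear_map_on_diff[OF representation_onD(1)[OF R] sD]
  note r2 = linear_map_onD[OF representation_onD(2)[OF R]]
  note D = subspace_add[OF sD] subspace_diff[OF sD]
  have mem: "ext_bracket br \<rho> \<alpha> a b \<in> ?D \<times> H" if "a \<in> ?D \<times> H" "b \<in> ?D \<times> H" for a b
    using that by (auto simp: br al r1 D)
  have "alternating_map_on (?D \<times> H) (?D \<times> H) (ext_bracket br \<rho> \<alpha>)"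
    unfolding alternating_map_on_def
  proof (intro conjI ballI)
    fix a assume a: "a \<in> ?D \<times> H"
    obtain \<phi> x where ax: "a = (\<phi>, x)" by (cases a)
    have ph: "\<phi> \<in> ?D" "x \<in> H" using a ax by auto
    show "linear_map_on (?D \<times> H) (?D \<times> H) (\<lambda>b. ext_bracket br \<rho> \<alpha> a b)"
      using mem[OF a] unfolding linear_map_on_def ax
      by (auto simp: ph br al r1 r2(2) r2(3)[OF ph(1)] algebra_simps)
    show "linear_map_on (?D \<times> H) (?D \<times> H) (\<lambda>b. ext_bracket br \<rho> \<alpha> b a)"
      using mem[OF _ a] unfolding linear_map_on_def ax
      by (auto simp: ph br al r1 r2(2) r2(3)[OF ph(1)] algebra_simps)
    show "ext_bracket br \<rho> \<alpha> a a = 0"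
      using ph alternating_map_onD(3)[OF aH] alternating_map_onD(3)[OF a\<alpha>]
      by (simp add: ax zero_prod_def)
  qed
  moreover have "ext_bracket br \<rho> \<alpha> (ext_bracket br \<rho> \<alpha> a b) c
      + ext_bracket br \<rho> \<alpha> (ext_bracket br \<rho> \<alpha> b c) a
      + ext_bracket br \<rho> \<alpha> (ext_bracket br \<rho> \<alpha> c a) b = 0"
    if mem3: "a \<in> ?D \<times> H" "b \<in> ?D \<times> H" "c \<in> ?D \<times> H" for a b c
  proof -
    obtain \<phi> x \<eta> y \<zeta> z where abc: "a = (\<phi>, x)" "b = (\<eta>, y)" "c = (\<zeta>, z)"
      by (cases a; cases b; cases c)
    have ph: "\<phi> \<in> ?D" "\<eta> \<in> ?D" "\<zeta> \<in> ?D" "x \<in> H" "y \<in> H" "z \<in> H" using mem3 abc by auto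
    have expand: "\<rho> w (\<rho> u \<psi> - \<rho> v \<theta> + \<alpha> u v) = \<rho> w (\<rho> u \<psi>) - \<rho> w (\<rho> v \<theta>) + \<rho> w (\<alpha> u v)"
      if "w \<in> H" "u \<in> H" "v \<in> H" "\<psi> \<in> ?D" "\<theta> \<in> ?D" for w u v \<psi> \<theta>
      using that by (simp add: r1 al D)
    \<comment> \<open>The cocycle condition, solved for one of its terms so that it can be used for rewriting.\<close>
    have [simp]: "\<alpha> (br x y) z = \<rho> z (\<alpha> x y) + \<rho> x (\<alpha> y z) + \<rho> y (\<alpha> z x)
        - \<alpha> (br y z) x - \<alpha> (br z x) y"
      using coc[OF ph(4-6)] by (simp add: algebra_simps)
    show ?thesis
      using lie_algebraD(3)[OF L ph(4-6)] ph
      by (simp add: abc expand representation_onD(3)[OF R] zero_prod_def)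
  qed
  ultimately show ?thesis
    unfolding lie_algebra_def by (auto intro!: subspace_Times sD sH)
qed

lemma lie_algebra_abelian: "subspace V \<Longrightarrow> lie_algebra V (\<lambda>x y. 0)"
  unfolding lie_algebra_def alternating_map_on_def linear_map_on_def
  by (auto simp: subspace_0)

lemma cotangent_extension_ext_bracket_iff:
  assumes L: "lie_algebra H br" and R: "representation_on H br (dual_space H) \<rho>"
    and C: "two_cocycle H br (dual_space H) \<rho> \<alpha>"
  shows "cotangent_extension H br (ext_bracket br \<rho> \<alpha>) \<longleftrightarrow>
    (\<forall>x1\<in>H. \<forall>x2\<in>H. \<forall>x3\<in>H. \<alpha> x1 x2 x3 + \<alpha> x2 x3 x1 + \<alpha> x3 x1 x2 = 0) \<and>
    (\<forall>x\<in>H. \<forall>y\<in>H. \<forall>\<phi>\<in>dual_space H. \<rho> x \<phi> y - \<rho> y \<phi> x = - \<phi> (br x y))"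
    (is "_ \<longleftrightarrow> ?cond")
proof -
  let ?D = "dual_space H" and ?E = "ext_bracket br \<rho> \<alpha>"
  have sH: "subspace H" and aH: "alternating_map_on H H br" using lie_algebraD[OF L] by auto
  have a\<alpha>: "alternating_map_on H ?D \<alpha>" using C unfolding two_cocycle_def by auto
  note sD = subspace_dual_space[of H]
  note zeros = alternating_map_on_simps(8,9)[OF aH sH] alternating_map_on_simps(8,9)[OF a\<alpha> sH]
    linear_map_on_zero[OF representation_onD(1)[OF R] sD]
    linear_map_on_zero[OF representation_onD(2)[OF R] sH]
    subspace_0[OF sH] subspace_0[OF sD]
  have LE: "lie_algebra (?D \<times> H) ?E" by (rule lie_algebra_ext_bracket[OF L R C])
  have D_ne: "?D \<noteq> {}" using subspace_0[OF sD] by blast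
  have exact: "lie_short_exact ?D (\<lambda>\<phi> \<eta>. 0) (?D \<times> H) ?E H br (\<lambda>\<phi>. (\<phi>, 0)) snd"
    unfolding lie_short_exact_def lie_hom_def linear_map_on_def
    using L LE lie_algebra_abelian[OF sD] D_ne
    by (auto simp: zeros inj_on_def zero_prod_def image_iff)
  \<comment> \<open>The differential sorted by the functionals on which its terms depend.\<close>
  have ce: "ce_d ?E omega0 (\<phi>, x) (\<eta>, y) (\<zeta>, z) =
      (\<rho> y \<phi> z - \<rho> z \<phi> y + \<phi> (br y z)) + (\<rho> z \<eta> x - \<rho> x \<eta> z - \<eta> (br x z))
      + (\<rho> x \<zeta> y - \<rho> y \<zeta> x + \<zeta> (br x y)) - (\<alpha> x y z + \<alpha> y z x + \<alpha> z x y)"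
    if "x \<in> H" "y \<in> H" "z \<in> H" for \<phi> x \<eta> y \<zeta> z
    using alternating_map_on_antisym[OF a\<alpha> sH that(1,3)] by (simp add: ce_d_def)
  have "closed_two_form (?D \<times> H) ?E omega0 \<longleftrightarrow> ?cond"
  proof
    assume "closed_two_form (?D \<times> H) ?E omega0"
    then have cl: "ce_d ?E omega0 (\<phi>, x) (\<eta>, y) (\<zeta>, z) = 0"
      if "x \<in> H" "y \<in> H" "z \<in> H" "\<phi> \<in> ?D" "\<eta> \<in> ?D" "\<zeta> \<in> ?D" for \<phi> x \<eta> y \<zeta> z
      using that unfolding closed_two_form_def by auto
    have c1: "\<alpha> x y z + \<alpha> y z x + \<alpha> z x y = 0" if "x \<in> H" "y \<in> H" "z \<in> H" for x y z
      using cl[OF that, of 0 0 0] that by (simp add: ce zeros)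
    moreover have "\<rho> x \<phi> y - \<rho> y \<phi> x = - \<phi> (br x y)" if "x \<in> H" "y \<in> H" "\<phi> \<in> ?D" for x y \<phi>
    proof -
      have "\<alpha> x y 0 = 0"
        using linear_map_on_zero[OF dual_spaceD(1) sH] alternating_map_on_simps(1)[OF a\<alpha> sH that(1,2)]
        by blast
      then show ?thesis using cl[of 0 x y \<phi> 0 0] that by (simp add: ce zeros)
    qed
    ultimately show ?cond by blast
  next
    assume cond: ?cond
    have "ce_d ?E omega0 (\<phi>, x) (\<eta>, y) (\<zeta>, z) = 0"
      if H: "x \<in> H" "y \<in> H" "z \<in> H" and D: "\<phi> \<in> ?D" "\<eta> \<in> ?D" "\<zeta> \<in> ?D" for \<phi> x \<eta> y \<zeta> z
    proof -
      have "\<rho> y \<phi> z - \<rho> z \<phi> y = - \<phi> (br y z)" "\<rho> x \<eta> z - \<rho> z \<eta> x = - \<eta> (br x z)"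
        "\<rho> x \<zeta> y - \<rho> y \<zeta> x = - \<zeta> (br x y)" "\<alpha> x y z + \<alpha> y z x + \<alpha> z x y = 0"
        using cond H D by blast+
      then show ?thesis by (simp add: ce[OF H])
    qed
    then show "closed_two_form (?D \<times> H) ?E omega0"
      unfolding closed_two_form_def using alternating_omega0[OF sH] by auto
  qed
  then show ?thesis unfolding cotangent_extension_def using exact by simp
qed

section \<open>Non-degeneracy from a non-vanishing top power\<close>

text \<open>
  Composing with the transposition of \<open>a\<close> and \<open>b\<close> permutes the summands of the exterior product; it
  does not change the vectors that are inserted but it changes the sign. So the sum is equal to
  its own negative, whatever \<open>\<beta>\<close> and \<open>\<gamma>\<close> are.
\<close>

lemma wedge_eq_0_of_repeated:
  assumes ab: "a < k + l" "b < k + l" "a \<noteq> b" and eq: "v a = v b"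
  shows "wedge k l \<beta> \<gamma> v = 0"
proof -
  let ?q = "Transposition.transpose a b" and ?S = "{p. p permutes {..<k + l}}"
  let ?t = "\<lambda>p. of_int (sign p) * \<beta> (\<lambda>i. v (p i)) * \<gamma> (\<lambda>i. v (p (k + i)))"
  have q: "?q permutes {..<k + l}" using ab by (auto intro: permutes_swap_id)
  have vq: "v (?q i) = v i" for i using eq by (auto simp: Transposition.transpose_def)
  have neg: "?t (?q \<circ> p) = - ?t p" if "p \<in> ?S" for p
  proof -
    have "permutation p" using that by (auto simp: permutation_permutes)
    then have "sign (?q \<circ> p) = - sign p"
      using ab by (simp add: sign_compose permutation_swap_id sign_swap_id)
    then show ?thesis by (simp add: vq)
  qed
  have "sum ?t ?S = (\<Sum>p\<in>?S. ?t (?q \<circ> p))"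
    by (rule setum_permutations_compose_left[OF q])
  also have "\<dots> = - sum ?t ?S" using neg by (simp add: sum_negf)
  finally have "sum ?t ?S = 0" by simp
  then show ?thesis unfolding wedge_def by simp
qed

lemma less_2_plus_cases:
  fixes i :: nat
  assumes "i < 2 + m"
  obtains "i = 0" | "i = 1" | i' where "i = 2 + i'" "i' < m"
proof -
  have "i = 0 \<or> i = 1 \<or> i = 2 + (i - 2) \<and> i - 2 < m" using assms by arith
  then show thesis using that by blast
qed

text \<open>
  In each summand the radical vector ends up in exactly one factor: in one of the two slots of
  \<open>\<omega>\<close>, or in the lower power, where the induction hypothesis applies.
\<close>

lemma wedge_power_radical:
  assumes alt: "alternating_map_on G UNIV \<omega>" "subspace G"
    and "\<And>i. i < 2 * n \<Longrightarrow> v i \<in> G" "j < 2 * n" "\<And>y. y \<in> G \<Longrightarrow> \<omega> (v j) y = 0"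
  shows "wedge_power \<omega> n v = 0"
  using assms(3-)
proof (induction n arbitrary: v j)
  case (Suc n)
  have "of_int (sign p) * \<omega> (v (p 0)) (v (p 1)) * wedge_power \<omega> n (\<lambda>i. v (p (2 + i))) = 0"
    if p: "p permutes {..<2 + 2 * n}" for p
  proof -
    have pG: "v (p i) \<in> G" if "i < 2 + 2 * n" for i
      using permutes_in_image[OF p, of i] Suc.prems(1) that by auto
    have "j \<in> p ` {..<2 + 2 * n}" using permutes_image[OF p] Suc.prems(2) by simp
    then obtain i where i: "i < 2 + 2 * n" "p i = j" by auto
    consider "i = 0" | "i = 1" | i' where "i = 2 + i'" "i' < 2 * n"
      using i(1) by (rule less_2_plus_cases)
    then show ?thesis
    proof cases
      case 1
      then show ?thesis using Suc.prems(3) i(2) pG[of 1] by simp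
    next
      case 2
      have "\<omega> (v (p 0)) (v (p 1)) = - \<omega> (v (p 1)) (v (p 0))"
        by (rule alternating_map_on_antisym[OF alt]) (auto intro: pG)
      then show ?thesis using 2 Suc.prems(3) i(2) pG[of 0] by simp
    next
      case 3
      have "wedge_power \<omega> n (\<lambda>i. v (p (2 + i))) = 0"
        by (rule Suc.IH[of _ i']) (use 3 i pG Suc.prems(3) in auto)
      then show ?thesis by simp
    qed
  qed
  then have "(\<Sum>p | p permutes {..<2 + 2 * n}. of_int (sign p) * \<omega> (v (p 0)) (v (p 1))
      * wedge_power \<omega> n (\<lambda>i. v (p (2 + i)))) = 0"
    by (intro sum.neutral) auto
  then show ?case
    by (simp only: wedge_power.simps wedge_def div_0)
qed simp

text \<open>
  Linearity also follows summand by summand: a permutation moves the slot \<open>j\<close> into exactly one of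
  the factors, and the other factors do not depend on \<open>t\<close>.
\<close>

lemma wedge_power_slot_linear:
  assumes alt: "alternating_map_on G UNIV \<omega>"
    and "\<And>i. i < 2 * n \<Longrightarrow> v i \<in> G" "j < 2 * n"
  shows "linear_map_on G UNIV (\<lambda>t. wedge_power \<omega> n (v(j := t)))"
  using assms(2-)
proof (induction n arbitrary: v j)
  case (Suc n)
  have "linear_map_on G UNIV (\<lambda>t. of_int (sign p) * \<omega> ((v(j := t)) (p 0)) ((v(j := t)) (p 1))
      * wedge_power \<omega> n (\<lambda>i. (v(j := t)) (p (2 + i))))"
    (is "linear_map_on G UNIV ?g") if p: "p permutes {..<2 + 2 * n}" for p
  proof -
    have pG: "v (p i) \<in> G" if "i < 2 + 2 * n" for i
      using permutes_in_image[OF p, of i] Suc.prems(1) that by auto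
    have "j \<in> p ` {..<2 + 2 * n}" using permutes_image[OF p] Suc.prems(2) by simp
    then obtain i where i: "i < 2 + 2 * n" "p i = j" by auto
    have upd: "(v(j := t)) (p m) = (if m = i then t else v (p m))" for t m
      using i(2) permutes_inj[OF p] by (auto dest: injD)
    consider "i = 0" | "i = 1" | i' where "i = 2 + i'" "i' < 2 * n"
      using i(1) by (rule less_2_plus_cases)
    then show ?thesis
    proof cases
      case 1
      then have "?g = (\<lambda>t. \<omega> t (v (p 1)) *
          (of_int (sign p) * wedge_power \<omega> n (\<lambda>i. v (p (2 + i)))))"
        unfolding upd by auto
      then show ?thesis
        using linear_map_on_times_const alternating_map_onD(2)[OF alt pG[of 1]] by simp
    next
      case 2
      then have "?g = (\<lambda>t. \<omega> (v (p 0)) t *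
          (of_int (sign p) * wedge_power \<omega> n (\<lambda>i. v (p (2 + i)))))"
        unfolding upd by auto
      then show ?thesis
        using linear_map_on_times_const alternating_map_onD(1)[OF alt pG[of 0]] by simp
    next
      case 3
      have "(\<lambda>m. (v(j := t)) (p (2 + m))) = (\<lambda>m. v (p (2 + m)))(i' := t)" for t
        unfolding upd using 3 by auto
      moreover have "(v(j := t)) (p 0) = v (p 0)" "(v(j := t)) (p 1) = v (p 1)" for t
        unfolding upd using 3 by auto
      ultimately have g: "?g = (\<lambda>t. wedge_power \<omega> n ((\<lambda>m. v (p (2 + m)))(i' := t)) *
          (of_int (sign p) * \<omega> (v (p 0)) (v (p 1))))"
        by (simp add: mult_ac)
      have "linear_map_on G UNIV (\<lambda>t. wedge_power \<omega> n ((\<lambda>m. v (p (2 + m)))(i' := t)))"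
        by (rule Suc.IH) (use 3 pG in auto)
      then show ?thesis unfolding g by (rule linear_map_on_times_const)
    qed
  qed
  then have "linear_map_on G UNIV (\<lambda>t. (\<Sum>p | p permutes {..<2 + 2 * n}.
      of_int (sign p) * \<omega> ((v(j := t)) (p 0)) ((v(j := t)) (p 1))
      * wedge_power \<omega> n (\<lambda>i. (v(j := t)) (p (2 + i)))) * (1 / (fact 2 * fact (2 * n))))"
    by (intro linear_map_on_times_const linear_map_on_sum) auto
  then show ?case
    by (simp only: wedge_power.simps wedge_def times_divide_eq_right mult_1_right)
qed simp

definition nondegenerate_on :: "'a::real_vector set \<Rightarrow> ('a \<Rightarrow> 'a \<Rightarrow> real) \<Rightarrow> bool" where
  "nondegenerate_on V b \<longleftrightarrow> (\<forall>r\<in>V. (\<forall>y\<in>V. b r y = 0) \<longrightarrow> r = 0)"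

lemma nondegenerate_onI:
  "(\<And>r. r \<in> V \<Longrightarrow> (\<And>y. y \<in> V \<Longrightarrow> b r y = 0) \<Longrightarrow> r = 0) \<Longrightarrow> nondegenerate_on V b"
  unfolding nondegenerate_on_def by blast

lemma nondegenerate_onD:
  "nondegenerate_on V b \<Longrightarrow> r \<in> V \<Longrightarrow> (\<And>y. y \<in> V \<Longrightarrow> b r y = 0) \<Longrightarrow> r = 0"
  unfolding nondegenerate_on_def by blast

text \<open>
  Suppose that \<open>r\<close> is a non-zero radical vector. The \<open>2 n + 1\<close> vectors \<open>r\<close> and \<open>v i\<close> in a space of
  dimension \<open>2 n\<close> satisfy a non-trivial linear relation, and some \<open>v j\<close> has a non-zero coefficient
  \<open>c\<close> in it because \<open>r\<close> is not zero. Evaluate the top power with the combination of the \<open>v i\<close>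
  from this relation in the slot \<open>j\<close>. By linearity and alternation the value is \<open>c\<close> times the value
  at \<open>v\<close>; but the combination is a multiple of \<open>r\<close>, so the value is zero.
\<close>

lemma nondegenerate_of_wedge_power:
  assumes alt: "alternating_map_on G UNIV \<omega>" "subspace G" and dim: "has_dim G (2 * n)"
    and vG: "\<And>i. i < 2 * n \<Longrightarrow> v i \<in> G" and nz: "wedge_power \<omega> n v \<noteq> 0"
  shows "nondegenerate_on G \<omega>"
proof (rule nondegenerate_onI, rule ccontr)
  fix r assume r: "r \<in> G" "\<And>y. y \<in> G \<Longrightarrow> \<omega> r y = 0" and "r \<noteq> 0"
  let ?N = "{..<2 * n}"
  obtain B where B: "finite B" "card B = 2 * n" "span B = G"
    using dim unfolding has_dim_def by auto
  have rep: "wedge_power \<omega> n u = 0" if "i \<noteq> j" "i < 2 * n" "j < 2 * n" "u i = u j" for u i j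
  proof (cases n)
    case (Suc m)
    then show ?thesis using wedge_eq_0_of_repeated[of i 2 "2 * m" j u] that by simp
  qed (use that in simp)
  \<comment> \<open>Dependence is a property of a set, so repetitions among \<open>r\<close> and the \<open>v i\<close> are excluded first.\<close>
  have inj: "inj_on v ?N" using rep nz by (meson inj_onI lessThan_iff)
  have notin: "r \<notin> v ` ?N"
    using wedge_power_radical[OF alt vG] nz r(2) by auto
  have "card (insert r (v ` ?N)) = Suc (2 * n)"
    using inj notin by (simp add: card_image)
  moreover have "insert r (v ` ?N) \<subseteq> span B" using B vG r by auto
  ultimately have "dependent (insert r (v ` ?N))"
    using independent_span_bound[OF B(1), of "insert r (v ` ?N)"] B(2) by auto
  then obtain c where c: "\<exists>x\<in>insert r (v ` ?N). c x \<noteq> 0"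
      "(\<Sum>x\<in>insert r (v ` ?N). c x *\<^sub>R x) = 0"
    by (auto simp: dependent_finite)
  have rel: "c r *\<^sub>R r + (\<Sum>i\<in>?N. c (v i) *\<^sub>R v i) = 0"
    using c(2) notin inj by (simp add: sum.reindex)
  obtain j where j: "j < 2 * n" "c (v j) \<noteq> 0"
  proof (rule ccontr)
    assume "\<not> thesis"
    then have z: "\<And>i. i < 2 * n \<Longrightarrow> c (v i) = 0" using that by blast
    then have "c r *\<^sub>R r = 0" using rel by simp
    then show False using z c(1) \<open>r \<noteq> 0\<close> by auto
  qed
  let ?f = "\<lambda>t. wedge_power \<omega> n (v(j := t))"
  let ?s = "\<Sum>i\<in>?N. c (v i) *\<^sub>R v i"
  have "?f ?s = (\<Sum>i\<in>?N. c (v i) *\<^sub>R ?f (v i))"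
    by (rule linear_map_on_lincomb[OF wedge_power_slot_linear[OF alt(1)] alt(2)]) (use vG j in auto)
  also have "\<dots> = (\<Sum>i\<in>?N. if i = j then c (v j) * wedge_power \<omega> n v else 0)"
  proof (rule sum.cong[OF refl])
    fix i assume i: "i \<in> ?N"
    show "c (v i) *\<^sub>R ?f (v i) = (if i = j then c (v j) * wedge_power \<omega> n v else 0)"
      using rep[of i j "v(j := v i)"] i j by auto
  qed
  also have "\<dots> = c (v j) * wedge_power \<omega> n v" using j by simp
  finally have ne: "?f ?s \<noteq> 0" using j nz by simp
  have s: "?s = (- c r) *\<^sub>R r" using rel by (simp add: eq_neg_iff_add_eq_0 add.commute)
  have "?f ?s = 0"
  proof (rule wedge_power_radical[OF alt _ j(1)])
    show "(v(j := ?s)) i \<in> G" if "i < 2 * n" for i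
      unfolding s using vG that r alt(2) by (auto intro!: subspace_scale subspace_neg)
    show "\<omega> ((v(j := ?s)) j) y = 0" if "y \<in> G" for y
      unfolding s using alternating_map_on_simps(6)[OF alt r(1) that, of "- c r"] r(2)[OF that] by simp
  qed
  with ne show False by contradiction
qed

text \<open>
  This gives access to the results on linear maps that are defined on a whole type.
\<close>

lemma linear_extension_of_linear_map_on:
  assumes "linear_map_on V W f" "subspace V"
  obtains g where "linear g" "\<And>x. x \<in> V \<Longrightarrow> g x = f x"
proof -
  obtain B where B: "B \<subseteq> V" "independent B" "V \<subseteq> span B"
    by (rule maximal_independent_subset)
  have V: "span B = V" using B assms(2) by (simp add: span_subspace)
  obtain g where g: "linear g" "\<forall>x\<in>B. g x = f x"
    using linear_independent_extend[OF B(2)] by blast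
  have "linear_map_on (span B) UNIV g"
    using g(1) by (auto simp: linear_map_on_def linear_add linear_scale)
  then have "g x = f x" if "x \<in> V" for x
    using linear_map_on_eq_on_span[of B UNIV g W f x] assms(1) g(2) V that by auto
  with g(1) that show thesis by blast
qed

text \<open>
  Over a basis \<open>B\<close> of \<open>G\<close>, the endomorphism that sends \<open>g\<close> to the vector with coordinates \<open>\<omega> g b\<close>
  is injective by non-degeneracy, hence surjective because the dimension is finite. A preimage of
  the vector with coordinates \<open>f b\<close> represents \<open>f\<close>.
\<close>

lemma functional_representable:
  assumes alt: "alternating_map_on G UNIV \<omega>" "subspace G" and dim: "has_dim G N"
    and nd: "nondegenerate_on G \<omega>"
    and f: "linear_map_on G UNIV (f :: _ \<Rightarrow> real)"
  obtains g where "g \<in> G" "\<And>y. y \<in> G \<Longrightarrow> \<omega> g y = f y"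
proof -
  obtain B where B: "finite B" "independent B" "span B = G"
    using dim unfolding has_dim_def by auto
  have BG: "b \<in> G" if "b \<in> B" for b using that B(3) span_base by blast
  let ?T = "\<lambda>g. \<Sum>b\<in>B. \<omega> g b *\<^sub>R b"
  have TG: "(\<Sum>b\<in>B. c b *\<^sub>R b) \<in> G" for c
    using alt(2) BG by (auto intro!: subspace_sum subspace_scale)
  have coeff: "\<forall>b\<in>B. c b = d b" if "(\<Sum>b\<in>B. c b *\<^sub>R b) = (\<Sum>b\<in>B. d b *\<^sub>R b)" for c d
  proof -
    have "(\<Sum>b\<in>B. (c b - d b) *\<^sub>R b) = 0"
      using that by (simp add: scaleR_left_diff_distrib sum_subtractf)
    then show ?thesis using independentD[OF B(2,1) subset_refl, of "\<lambda>b. c b - d b"] by simp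
  qed
  have onB: "\<omega> g y = h y" if "g \<in> G" "linear_map_on G UNIV h" "\<forall>b\<in>B. \<omega> g b = h b" "y \<in> G" for g h y
    using linear_map_on_eq_on_span[of B UNIV "\<omega> g" UNIV h y] alternating_map_onD(1)[OF alt(1)] that B(3)
    by auto
  have "linear_map_on G G ?T"
    unfolding linear_map_on_def
    using TG BG by (auto simp: alternating_map_on_simps[OF alt] scaleR_add_left sum.distrib scaleR_sum_right)
  then obtain T where T: "linear T" "\<And>x. x \<in> G \<Longrightarrow> T x = ?T x"
    by (rule linear_extension_of_linear_map_on[OF _ alt(2)]) blast
  have zero: "x = 0" if "x \<in> G" "T x = 0" for x
  proof (rule nondegenerate_onD[OF nd that(1)])
    fix y assume "y \<in> G"
    have "\<forall>b\<in>B. \<omega> x b = 0" using coeff[of "\<omega> x" "\<lambda>_. 0"] that T(2) by simp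
    then show "\<omega> x y = 0"
      using onB[OF that(1), of "\<lambda>_. 0"] \<open>y \<in> G\<close> by (simp add: linear_map_on_def)
  qed
  have inj: "inj_on T (span B)"
  proof (rule inj_onI)
    fix x y assume "x \<in> span B" "y \<in> span B" "T x = T y"
    then have "x - y = 0"
      using zero[of "x - y"] T(1) B(3) alt(2) by (simp add: linear_diff subspace_diff)
    then show "x = y" by simp
  qed
  have ind: "independent (T ` B)"
    using linear_independent_injective_image[OF T(1) B(2) inj] .
  have "T ` B \<subseteq> G" using T(2) TG BG by auto
  have "card (T ` B) = card B"
    using inj by (meson card_image inj_on_subset span_superset)
  \<comment> \<open>A vector outside this span would give an independent set with more elements than \<open>B\<close>.\<close>
  have "G \<subseteq> span (T ` B)"
  proof (rule ccontr)
    assume "\<not> ?thesis"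
    then obtain x where x: "x \<in> G" "x \<notin> span (T ` B)" by auto
    have "independent (insert x (T ` B))" using ind x(2) by (simp add: independent_insert)
    moreover have "insert x (T ` B) \<subseteq> span B" using x B(3) \<open>T ` B \<subseteq> G\<close> by auto
    ultimately have "card (insert x (T ` B)) \<le> card B"
      using independent_span_bound[OF B(1)] by blast
    moreover have "x \<notin> T ` B" using x(2) span_superset[of "T ` B"] by blast
    ultimately show False using \<open>card (T ` B) = card B\<close> B(1) by simp
  qed
  moreover have "span (T ` B) = T ` G" using linear_span_image[OF T(1), of B] B(3) by simp
  ultimately have "G \<subseteq> T ` G" by simp
  then obtain g where g: "g \<in> G" "(\<Sum>b\<in>B. f b *\<^sub>R b) = T g" using TG[of f] by blast
  have "\<forall>b\<in>B. \<omega> g b = f b" using coeff[of "\<omega> g" f] g T(2) by simp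
  then show thesis using that[OF g(1)] onB[OF g(1) f] by blast
qed

section \<open>Lagrangian complements\<close>

lemma linear_projection_along:
  assumes "subspace W" "W \<subseteq> G" "subspace G"
  obtains P where "linear P" "\<And>x. x \<in> W \<Longrightarrow> P x = 0" "\<And>x. x \<in> G \<Longrightarrow> x - P x \<in> W"
proof -
  obtain C where C: "C \<subseteq> W" "independent C" "W \<subseteq> span C"
    by (rule maximal_independent_subset)
  obtain B where B: "C \<subseteq> B" "B \<subseteq> G" "independent B" "G \<subseteq> span B"
    by (rule maximal_independent_subset_extend[OF subset_trans[OF C(1) assms(2)] C(2)])
  obtain P where P: "linear P" "\<forall>b\<in>B. P b = (if b \<in> C then 0 else b)"
    using linear_independent_extend[OF B(3), of "\<lambda>b. if b \<in> C then 0 else b"] by blast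
  have "P x = 0" if "x \<in> W" for x
  proof (rule linear_eq_0_on_span[OF P(1)])
    show "x \<in> span C" using C(3) that by auto
    show "P b = 0" if "b \<in> C" for b using P(2) B(1) that by auto
  qed
  moreover have "x - P x \<in> W" if "x \<in> G" for x
  proof -
    have "x \<in> span B" using B(4) that by auto
    then show ?thesis
    proof (induction rule: span_induct_alt)
      case base
      then show ?case using P(1) assms(1) by (simp add: linear_0 subspace_0)
    next
      case (step c b y)
      have "b - P b \<in> W" using P(2) step(1) C(1) assms(1) by (auto simp: subspace_0)
      then have "c *\<^sub>R (b - P b) + (y - P y) \<in> W"
        using step(2) assms(1) by (auto intro: subspace_add subspace_scale)
      moreover have "c *\<^sub>R (b - P b) + (y - P y) = c *\<^sub>R b + y - P (c *\<^sub>R b + y)"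
        using P(1) by (simp add: linear_add linear_scale algebra_simps)
      ultimately show ?case by simp
    qed
  qed
  ultimately show thesis using P(1) that by blast
qed

text \<open>
  Start from any linear projection \<open>P\<close> along \<open>W\<close>. For each \<open>x\<close>, the functional
  \<open>y \<mapsto> - \<omega> (P x) (P y) / 2\<close> vanishes on \<open>W\<close>, so it is \<open>\<omega> (T x)\<close> for a vector \<open>T x\<close> in
  \<open>W\<close>. Then \<open>Q = P + T\<close> works: in \<open>\<omega> (Q x) (Q y)\<close> each of the two mixed terms
  contributes \<open>- \<omega> (P x) (P y) / 2\<close>, the first by the choice of \<open>T x\<close> and the second by the choice of
  \<open>T y\<close> and antisymmetry, and the term from \<open>W\<close> alone vanishes.
\<close>

lemma lagrangian_projection:
  assumes alt: "alternating_map_on G UNIV \<omega>" "subspace G" and dim: "has_dim G N"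
    and nd: "nondegenerate_on G \<omega>"
    and lag: "lagrangian G \<omega> W"
  obtains Q where "linear_map_on G G Q" "\<And>x. x \<in> W \<Longrightarrow> Q x = 0" "\<And>x. x \<in> G \<Longrightarrow> x - Q x \<in> W"
    "\<And>x y. x \<in> G \<Longrightarrow> y \<in> G \<Longrightarrow> \<omega> (Q x) (Q y) = 0"
proof -
  have W: "subspace W" "W \<subseteq> G" "symp_orth G \<omega> W = W"
    using lag unfolding lagrangian_def by auto
  have iso: "\<omega> x y = 0" if "x \<in> W" "y \<in> W" for x y
    using that W(3) unfolding symp_orth_def by auto
  obtain P where P: "linear P" "\<And>x. x \<in> W \<Longrightarrow> P x = 0" "\<And>x. x \<in> G \<Longrightarrow> x - P x \<in> W"
    by (rule linear_projection_along[OF W(1,2) alt(2)]) blast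
  have PG: "P x \<in> G" if "x \<in> G" for x
    using subspace_diff[OF alt(2) that, of "x - P x"] P(3)[OF that] W(2) by auto
  have PP: "P (P x) = P x" if "x \<in> G" for x
    using P(2)[OF P(3)[OF that]] P(1) by (simp add: linear_diff)
  note om = alternating_map_on_simps[OF alt]
  have "\<exists>t. t \<in> W \<and> (\<forall>y\<in>G. \<omega> t y = - \<omega> (P x) (P y) / 2)" if x: "x \<in> G" for x
  proof -
    have "linear_map_on G UNIV (\<lambda>y. - \<omega> (P x) (P y) / 2)"
      using P(1) by (auto simp: linear_map_on_def om PG x linear_add linear_scale field_simps)
    then obtain t where t: "t \<in> G" "\<And>y. y \<in> G \<Longrightarrow> \<omega> t y = - \<omega> (P x) (P y) / 2"
      by (rule functional_representable[OF alt dim nd]) blast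
    have "t \<in> symp_orth G \<omega> W"
      unfolding symp_orth_def using t W(2) P(2) om(9)[OF PG[OF x]] by auto
    then show ?thesis using t W(3) by auto
  qed
  then obtain T where T: "\<And>x. x \<in> G \<Longrightarrow> T x \<in> W"
      "\<And>x y. x \<in> G \<Longrightarrow> y \<in> G \<Longrightarrow> \<omega> (T x) y = - \<omega> (P x) (P y) / 2"
    by metis
  have TG: "T x \<in> G" if "x \<in> G" for x using T(1) that W(2) by auto
  \<comment> \<open>Linearity of \<open>T\<close> comes from the uniqueness of representing vectors.\<close>
  have unique: "a = b" if "a \<in> G" "b \<in> G" "\<And>y. y \<in> G \<Longrightarrow> \<omega> a y = \<omega> b y" for a b
    using nondegenerate_onD[OF nd, of "a - b"] that alt(2) by (auto simp: om subspace_diff)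
  have Tadd: "T (x + y) = T x + T y" if "x \<in> G" "y \<in> G" for x y
    by (rule unique)
      (use that alt(2) P(1) in \<open>auto simp: om T(2) TG PG subspace_add linear_add field_simps\<close>)
  have Tscale: "T (c *\<^sub>R x) = c *\<^sub>R T x" if "x \<in> G" for x c
    by (rule unique)
      (use that alt(2) P(1) in \<open>auto simp: om T(2) TG PG subspace_scale linear_scale field_simps\<close>)
  have T0: "T x = 0" if "x \<in> W" for x
    by (rule unique)
      (use that W alt(2) P(2) in \<open>auto simp: om T(2) TG PG subspace_0 subsetD\<close>)
  let ?Q = "\<lambda>x. P x + T x"
  show thesis
  proof
    show "linear_map_on G G ?Q"
      unfolding linear_map_on_def using alt(2) P(1)
      by (auto simp: PG TG Tadd Tscale linear_add linear_scale subspace_add algebra_simps)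
    show "?Q x = 0" if "x \<in> W" for x using that P(2) T0 by simp
    show "x - ?Q x \<in> W" if "x \<in> G" for x
      using subspace_diff[OF W(1) P(3)[OF that] T(1)[OF that]] by (simp add: algebra_simps)
    show "\<omega> (?Q x) (?Q y) = 0" if "x \<in> G" "y \<in> G" for x y
    proof -
      have "\<omega> (P x) (T y) = - \<omega> (T y) (P x)" "\<omega> (P y) (P x) = - \<omega> (P x) (P y)"
        by (rule alternating_map_on_antisym[OF alt]; use that TG PG in simp)+
      then show ?thesis
        using that alt(2) iso[OF T(1) T(1)]
        by (simp add: om PG TG PP T(2) subspace_add)
    qed
  qed
qed

section \<open>Symplectic Lie algebras with a lagrangian ideal\<close>

lemma lie_algebra_transport:
  assumes L: "lie_algebra G br" and M: "subspace M"
    and lin: "linear_map_on G M \<Phi>" and bij: "bij_betw \<Phi> G M"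
  defines "E \<equiv> \<lambda>a b. \<Phi> (br (inv_into G \<Phi> a) (inv_into G \<Phi> b))"
  shows "lie_algebra M E" and "lie_iso G br M E \<Phi>"
proof -
  have sG: "subspace G" and aG: "alternating_map_on G G br" using lie_algebraD[OF L] by auto
  note br = alternating_map_on_simps[OF aG sG]
  note lins = linear_map_onD[OF lin]
  have E: "E (\<Phi> x) (\<Phi> y) = \<Phi> (br x y)" if "x \<in> G" "y \<in> G" for x y
    using that bij by (simp add: E_def bij_betw_inv_into_left)
  have img: "M = \<Phi> ` G" using bij by (simp add: bij_betw_def)
  have add: "\<Phi> x + \<Phi> y = \<Phi> (x + y)" if "x \<in> G" "y \<in> G" for x y
    using that by (simp add: lins)
  have scale: "c *\<^sub>R \<Phi> x = \<Phi> (c *\<^sub>R x)" if "x \<in> G" for x c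
    using that by (simp add: lins)
  note G = subspace_add[OF sG] subspace_scale[OF sG]
  have alt: "alternating_map_on M M E"
    unfolding alternating_map_on_def linear_map_on_def img
    by (auto simp: add scale E br G alternating_map_onD(3)[OF aG] linear_map_on_zero[OF lin sG])
  have jac: "E (E a b) c + E (E b c) a + E (E c a) b = 0" if abc: "a \<in> M" "b \<in> M" "c \<in> M" for a b c
  proof -
    obtain x y z where xyz: "x \<in> G" "y \<in> G" "z \<in> G" "a = \<Phi> x" "b = \<Phi> y" "c = \<Phi> z"
      using abc unfolding img by auto
    then show ?thesis
      by (simp add: E br add G lie_algebraD(3)[OF L] linear_map_on_zero[OF lin sG])
  qed
  show "lie_algebra M E" unfolding lie_algebra_def using M alt jac by blast
  show "lie_iso G br M E \<Phi>" unfolding lie_iso_def lie_hom_def using lin bij E by simp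
qed

lemma lagrangian_ideal_abelian:
  assumes L: "lie_algebra G br" and cl: "closed_two_form G br \<omega>"
    and nd: "nondegenerate_on G \<omega>"
    and ideal: "lie_ideal G br W" and lag: "lagrangian G \<omega> W"
    and v: "v \<in> W" and w: "w \<in> W"
  shows "br v w = 0"
proof (rule nondegenerate_onD[OF nd])
  have sG: "subspace G" and aG: "alternating_map_on G G br" using lie_algebraD[OF L] by auto
  have WG: "W \<subseteq> G" and sW: "subspace W" and idl: "\<And>x u. x \<in> G \<Longrightarrow> u \<in> W \<Longrightarrow> br x u \<in> W"
    using ideal unfolding lie_ideal_def by auto
  have iso: "\<omega> a b = 0" if "a \<in> W" "b \<in> W" for a b
    using that lag unfolding lagrangian_def symp_orth_def by auto
  show "br v w \<in> G" using idl v w WG by auto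
  fix y assume y: "y \<in> G"
  have idr: "br u y \<in> W" if "u \<in> W" for u
    using alternating_map_on_antisym[OF aG sG y, of u] idl[OF y that] that WG sW
    by (auto simp: subspace_neg)
  have "ce_d br \<omega> v w y = 0" using cl v w y WG unfolding closed_two_form_def by auto
  then show "\<omega> (br v w) y = 0" by (simp add: ce_d_def iso idr v w)
qed

text \<open>
  The space \<open>H\<close>, the image of the projection \<open>Q\<close>, is a model of the quotient \<open>G/W\<close> inside \<open>G\<close>, with
  the bracket \<open>Q [x, y]\<close>. Since \<open>W\<close> is an ideal, \<open>Q [x, y]\<close> depends only on \<open>Q x\<close> and \<open>Q y\<close>; this
  yields both the Jacobi identity on \<open>H\<close> and the compatibility of the projection with the brackets.
\<close>

lemma cotangent_solution_of_lagrangian_ideal: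
  assumes S: "symplectic_lie_algebra n G br \<omega>"
    and ideal: "lie_ideal G br W" and lag: "lagrangian G \<omega> W"
  shows "cotangent_solution G br \<omega>"
proof -
  have L: "lie_algebra G br" and dim: "has_dim G (2 * n)" and cl: "closed_two_form G br \<omega>"
    using S unfolding symplectic_lie_algebra_def by auto
  have sG: "subspace G" and aG: "alternating_map_on G G br" using lie_algebraD[OF L] by auto
  have alt: "alternating_map_on G UNIV \<omega>" using cl unfolding closed_two_form_def by auto
  have nd: "nondegenerate_on G \<omega>"
    using S nondegenerate_of_wedge_power[OF alt sG dim] unfolding symplectic_lie_algebra_def by blast
  have W: "subspace W" "W \<subseteq> G" "symp_orth G \<omega> W = W"
    using lag unfolding lagrangian_def by auto
  have iso: "\<omega> x y = 0" if "x \<in> W" "y \<in> W" for x y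
    using that W(3) unfolding symp_orth_def by auto
  note om = alternating_map_on_simps[OF alt sG]
  note br = alternating_map_on_simps[OF aG sG]
  have idl: "br x w \<in> W" and idr: "br w x \<in> W" if "x \<in> G" "w \<in> W" for x w
  proof -
    show *: "br x w \<in> W" using ideal that unfolding lie_ideal_def by auto
    show "br w x \<in> W"
      using alternating_map_on_antisym[OF aG sG, of x w] * that W by (auto simp: subspace_neg)
  qed
  obtain Q where Q: "linear_map_on G G Q" "\<And>x. x \<in> W \<Longrightarrow> Q x = 0" "\<And>x. x \<in> G \<Longrightarrow> x - Q x \<in> W"
    "\<And>x y. x \<in> G \<Longrightarrow> y \<in> G \<Longrightarrow> \<omega> (Q x) (Q y) = 0"
    by (rule lagrangian_projection[OF alt sG dim nd lag]) blast
  note Qs = linear_map_onD[OF Q(1)] linear_map_on_diff[OF Q(1) sG]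
  have QQ: "Q (Q x) = Q x" if "x \<in> G" for x
    using Q(2)[OF Q(3)[OF that]] Qs that by simp
  have Qbr: "Q (br (Q x) y) = Q (br x y)" "Q (br y (Q x)) = Q (br y x)" if "x \<in> G" "y \<in> G" for x y
    using Q(2)[OF idr[OF that(2) Q(3)[OF that(1)]]] Q(2)[OF idl[OF that(2) Q(3)[OF that(1)]]]
      that by (simp_all add: br Qs)
  define H where "H = Q ` G"
  define brH where "brH = (\<lambda>x y. Q (br x y))"
  \<comment> \<open>As \<open>H\<close> is isotropic, the functional \<open>\<omega> x\<close> on \<open>H\<close> depends only on the component of \<open>x\<close> in \<open>W\<close>.\<close>
  define \<Phi> where "\<Phi> = (\<lambda>x. (\<lambda>y. if y \<in> H then \<omega> x y else 0, Q x))"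
  let ?D = "dual_space H"
  have HG: "H \<subseteq> G" unfolding H_def using Qs by auto
  have QH: "Q x \<in> H" if "x \<in> G" for x unfolding H_def using that by simp
  have HQ: "Q x = x" if "x \<in> H" for x using that QQ unfolding H_def by auto
  have sH: "subspace H"
    unfolding subspace_def
  proof (intro conjI allI ballI)
    show "0 \<in> H" using HQ QH subspace_0[OF sG] linear_map_on_zero[OF Q(1) sG] by metis
    show "x + y \<in> H" if "x \<in> H" "y \<in> H" for x y
      using QH[of "x + y"] Qs(2)[of x y] HQ that HG subspace_add[OF sG] by (metis subsetD)
    show "c *\<^sub>R x \<in> H" if "x \<in> H" for c x
      using QH[of "c *\<^sub>R x"] Qs(3)[of x c] HQ that HG subspace_scale[OF sG] by (metis subsetD)
  qed
  have LH: "lie_algebra H brH"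
  proof -
    have "alternating_map_on H H brH"
      unfolding alternating_map_on_def linear_map_on_def brH_def
      using HG QH by (auto simp: subset_iff br Qs alternating_map_onD(3)[OF aG]
          linear_map_on_zero[OF Q(1) sG])
    moreover have "brH (brH x y) z + brH (brH y z) x + brH (brH z x) y = 0"
      if "x \<in> H" "y \<in> H" "z \<in> H" for x y z
    proof -
      have G3: "x \<in> G" "y \<in> G" "z \<in> G" using that HG by auto
      have "Q (br (br x y) z + br (br y z) x + br (br z x) y) = 0"
        using lie_algebraD(3)[OF L G3] linear_map_on_zero[OF Q(1) sG] by simp
      then show ?thesis
        using G3 by (simp add: brH_def Qbr br Qs subspace_add[OF sG])
    qed
    ultimately show ?thesis unfolding lie_algebra_def using sH by blast
  qed
  have D: "fst (\<Phi> x) \<in> ?D" if "x \<in> G" for x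
    unfolding \<Phi>_def dual_space_def linear_map_on_def
    using that HG sH by (auto simp: om subset_iff subspace_add subspace_scale)
  have lin: "linear_map_on G (?D \<times> H) \<Phi>"
  proof -
    have "\<Phi> x \<in> ?D \<times> H" if "x \<in> G" for x
      using D[OF that] QH[OF that] by (simp add: mem_Times_iff \<Phi>_def)
    moreover have "\<Phi> (x + y) = \<Phi> x + \<Phi> y" if "x \<in> G" "y \<in> G" for x y
      using that HG by (auto simp: \<Phi>_def om Qs fun_eq_iff subset_iff)
    moreover have "\<Phi> (c *\<^sub>R x) = c *\<^sub>R \<Phi> x" if "x \<in> G" for x c
      using that HG by (auto simp: \<Phi>_def om Qs fun_eq_iff scaleR_fun_def subset_iff)
    ultimately show ?thesis unfolding linear_map_on_def by blast
  qed
  have inj: "inj_on \<Phi> G"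
  proof (rule inj_onI)
    fix x y assume xy: "x \<in> G" "y \<in> G" "\<Phi> x = \<Phi> y"
    let ?d = "x - y"
    have d: "?d \<in> G" using xy sG by (simp add: subspace_diff)
    have "\<Phi> ?d = 0" using linear_map_on_diff[OF lin sG xy(1,2)] xy(3) by simp
    then have d0: "Q ?d = 0" "\<And>z. z \<in> H \<Longrightarrow> \<omega> ?d z = 0"
      by (auto simp: \<Phi>_def zero_prod_def fun_eq_iff) (metis)
    have dW: "?d \<in> W" using Q(3)[OF d] d0(1) by simp
    have "?d = 0"
    proof (rule nondegenerate_onD[OF nd d])
      fix z assume z: "z \<in> G"
      have "\<omega> ?d (z - Q z) = 0" using iso[OF dW Q(3)[OF z]] .
      moreover have "\<omega> ?d (Q z) = 0" using d0(2) QH[OF z] by simp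
      ultimately show "\<omega> ?d z = 0" using om(5)[OF z Qs(1)[OF z] d] by simp
    qed
    then show "x = y" by simp
  qed
  have surj: "?D \<times> H \<subseteq> \<Phi> ` G"
  proof
    fix a assume "a \<in> ?D \<times> H"
    then obtain \<phi> h where a: "a = (\<phi>, h)" "\<phi> \<in> ?D" "h \<in> H" by auto
    have hG: "h \<in> G" using a HG by auto
    note ph = linear_map_onD[OF dual_spaceD(1)[OF a(2)]]
    \<comment> \<open>Extended to \<open>G\<close> by zero on \<open>W\<close>, the functional \<open>\<phi>\<close> is represented by an element of \<open>W\<close>.\<close>
    have "linear_map_on G UNIV (\<lambda>y. \<phi> (Q y))"
      by (auto simp: linear_map_on_def Qs QH ph)
    then obtain w where w: "w \<in> G" "\<And>y. y \<in> G \<Longrightarrow> \<omega> w y = \<phi> (Q y)"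
      by (rule functional_representable[OF alt sG dim nd]) blast
    have "w \<in> symp_orth G \<omega> W"
      unfolding symp_orth_def using w W(2) Q(2) linear_map_on_zero[OF dual_spaceD(1)[OF a(2)] sH]
      by auto
    then have wW: "w \<in> W" using W(3) by simp
    have "\<omega> (w + h) y = \<phi> y" if "y \<in> H" for y
      using that w HQ[OF that] HQ[OF a(3)] Q(4)[OF hG, of y] HG hG by (auto simp: om)
    moreover have "Q (w + h) = h" using Qs(2)[OF w(1) hG] Q(2)[OF wW] HQ[OF a(3)] by simp
    ultimately have "\<Phi> (w + h) = a"
      using dual_spaceD(2)[OF a(2)] by (auto simp: \<Phi>_def a(1) fun_eq_iff)
    moreover have "w + h \<in> G" using w hG sG by (simp add: subspace_add)
    ultimately show "a \<in> \<Phi> ` G" by blast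
  qed
  have bij: "bij_betw \<Phi> G (?D \<times> H)"
    unfolding bij_betw_def using inj surj linear_map_onD(1)[OF lin] by blast
  define E where "E = (\<lambda>a b. \<Phi> (br (inv_into G \<Phi> a) (inv_into G \<Phi> b)))"
  have LE: "lie_algebra (?D \<times> H) E" and isoE: "lie_iso G br (?D \<times> H) E \<Phi>"
    using lie_algebra_transport[OF L subspace_Times[OF subspace_dual_space sH] lin bij]
    unfolding E_def by auto
  have E: "E (\<Phi> x) (\<Phi> y) = \<Phi> (br x y)" if "x \<in> G" "y \<in> G" for x y
    using isoE that unfolding lie_iso_def lie_hom_def by simp
  have img: "\<Phi> ` G = ?D \<times> H" using bij by (simp add: bij_betw_def)
  have pull: "omega0 (\<Phi> x) (\<Phi> y) = \<omega> x y" if "x \<in> G" "y \<in> G" for x y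
  proof -
    have "\<omega> (x - Q x) (y - Q y) = 0" using iso Q(3) that by simp
    then have "\<omega> x y = \<omega> x (Q y) + \<omega> (Q x) y"
      using that Q(4) sG by (simp add: om Qs subspace_diff)
    moreover have "\<omega> (Q x) y = - \<omega> y (Q x)"
      by (rule alternating_map_on_antisym[OF alt sG]) (use that Qs in auto)
    ultimately show ?thesis using that QH by (simp add: \<Phi>_def)
  qed
  have closed: "closed_two_form (?D \<times> H) E omega0"
    unfolding closed_two_form_def
  proof (intro conjI alternating_omega0[OF sH] ballI)
    fix a b c assume "a \<in> ?D \<times> H" "b \<in> ?D \<times> H" "c \<in> ?D \<times> H"
    then obtain x y z where xyz: "x \<in> G" "y \<in> G" "z \<in> G" "a = \<Phi> x" "b = \<Phi> y" "c = \<Phi> z"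
      unfolding img[symmetric] by blast
    have "ce_d E omega0 a b c = ce_d br \<omega> x y z"
      using xyz by (simp add: ce_d_def E pull br)
    then show "ce_d E omega0 a b c = 0"
      using cl xyz unfolding closed_two_form_def by simp
  qed
  have abel: "E (\<phi>, 0) (\<eta>, 0) = 0" if D2: "\<phi> \<in> ?D" "\<eta> \<in> ?D" for \<phi> \<eta>
  proof -
    have pre: "\<exists>w\<in>W. \<Phi> w = (\<psi>, 0)" if "\<psi> \<in> ?D" for \<psi>
    proof -
      have "(\<psi>, 0) \<in> \<Phi> ` G" using that img subspace_0[OF sH] by simp
      then obtain w where w: "w \<in> G" "\<Phi> w = (\<psi>, 0)" by auto
      then have "w \<in> W" using Q(3)[OF w(1)] by (simp add: \<Phi>_def)
      with w show ?thesis by blast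
    qed
    obtain v w where vw: "v \<in> W" "w \<in> W" "\<Phi> v = (\<phi>, 0)" "\<Phi> w = (\<eta>, 0)"
      using pre[OF D2(1)] pre[OF D2(2)] by blast
    have "br v w = 0" using lagrangian_ideal_abelian[OF L cl nd ideal lag vw(1,2)] .
    then show ?thesis
      using E[of v w] vw W(2) linear_map_on_zero[OF lin sG] by auto
  qed
  have proj: "snd (E a b) = brH (snd a) (snd b)" if ab: "a \<in> ?D \<times> H" "b \<in> ?D \<times> H" for a b
  proof -
    obtain x y where xy: "x \<in> G" "y \<in> G" "a = \<Phi> x" "b = \<Phi> y"
      using ab unfolding img[symmetric] by blast
    have "snd (\<Phi> u) = Q u" for u by (simp add: \<Phi>_def)
    then show ?thesis using xy by (simp add: E brH_def Qbr Qs)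
  qed
  have "lie_short_exact ?D (\<lambda>\<phi> \<eta>. 0) (?D \<times> H) E H brH (\<lambda>\<phi>. (\<phi>, 0)) snd"
    unfolding lie_short_exact_def lie_hom_def linear_map_on_def
    using LH LE lie_algebra_abelian[OF subspace_dual_space, of H] subspace_0[OF subspace_dual_space, of H]
    by (auto simp: abel proj subspace_0[OF sH] inj_on_def image_iff zero_prod_def[symmetric])
  then have "cotangent_extension H brH E"
    unfolding cotangent_extension_def using closed by simp
  then show ?thesis unfolding cotangent_solution_def using isoE pull by blast
qed

theorem theorem3p6:
  fixes H :: "'a::real_vector set" and brH :: "'a \<Rightarrow> 'a \<Rightarrow> 'a" and n :: nat
    and \<rho> :: "'a \<Rightarrow> ('a \<Rightarrow> real) \<Rightarrow> ('a \<Rightarrow> real)"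
    and \<alpha> :: "'a \<Rightarrow> 'a \<Rightarrow> ('a \<Rightarrow> real)"
    and G :: "'g::real_vector set" and brG :: "'g \<Rightarrow> 'g \<Rightarrow> 'g"
    and \<omega> :: "'g \<Rightarrow> 'g \<Rightarrow> real" and m :: nat
  shows
    "(lie_algebra H brH \<and> has_dim H n \<and>
      representation_on H brH (dual_space H) \<rho> \<and>
      two_cocycle H brH (dual_space H) \<rho> \<alpha> \<longrightarrow>
        (cotangent_extension H brH (ext_bracket brH \<rho> \<alpha>) \<longleftrightarrow>
          (\<forall>x1\<in>H. \<forall>x2\<in>H. \<forall>x3\<in>H. \<alpha> x1 x2 x3 + \<alpha> x2 x3 x1 + \<alpha> x3 x1 x2 = 0) \<and>
          (\<forall>x\<in>H. \<forall>y\<in>H. \<forall>\<phi>\<in>dual_space H. \<rho> x \<phi> y - \<rho> y \<phi> x = - \<phi> (brH x y))))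
     \<and>
     (symplectic_lie_algebra m G brG \<omega> \<and>
      (\<exists>W. lie_ideal G brG W \<and> lagrangian G \<omega> W) \<longrightarrow>
        cotangent_solution G brG \<omega>)"
  using cotangent_extension_ext_bracket_iff[of H brH \<rho> \<alpha>]
    cotangent_solution_of_lagrangian_ideal[of m G brG \<omega>]
  by blast

end
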